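(* Let $M\in\mathbb{N}$, let $g\in\mathbb{C}^M$ be a random Steinhaus window, i.e. $g(m)=\frac{1}{\sqrt{M}}e^{2\pi i y_m}$ for $m\in\mathbb{Z}_M$, with $y_m$ independent and uniformly distributed on $[0,1)$. Let $\Lambda\subset\mathbb{Z}_M\times\mathbb{Z}_M$ be a (fixed) set, and consider the Gabor system $(g,\Lambda)$ with synthesis matrix $\Phi_\Lambda$. Then, for each fixed $\varepsilon\in(0,1)$, with probability at least $1-\varepsilon$, $$\sigma_{\max}^2(\Phi_\Lambda^* )\le \frac{|\Lambda|}{M}+\sqrt{\frac{|\Lambda|}{\varepsilon}\left(1-\frac{|\Lambda|}{M^2}\right)}.$$
   Context: Vectors $x\in\mathbb{C}^M$ are viewed as functions $x:\mathbb{Z}_M\to\mathbb{C}$, with index arithmetic modulo $M$. For $(k,\ell)\in\mathbb{Z}_M\times\mathbb{Z}_M$, the time-frequency shift operator $\pi(k,\ell)$ on $\mathbb{C}^M$ is $(\pi(k,\ell)x)(m)=e^{2\pi i\ell m/M}x(m-k)$. The Gabor system generated by the window $g$ and the set $\Lambda\subset\mathbb{Z}_M\times\mathbb{Z}_M$ is the family $(g,\Lambda)=\{\pi(k,\ell)g\}_{(k,\ell)\in\Lambda}$ (indexed by $\Lambda$). Its synthesis matrix $\Phi_\Lambda\in\mathbb{C}^{M\times|\Lambda|}$ has the vectors $\pi(\lambda)g$, $\lambda\in\Lambda$, as columns; the analysis matrix is the adjoint $\Phi_\Lambda^*$. Here $\sigma_{\max}^2(\Phi_\Lambda^* )=\max_{\|x\|_2=1}\sum_{\lambda\in\Lambda}|\langle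 x,\pi(\lambda)g\rangle|^2$, the maximum being over $x\in\mathbb{C}^M$ (the largest eigenvalue of $\Phi_\Lambda\Phi_\Lambda^*$). *)

theory Defs
  imports "HOL-Probability.Probability" "Jordan_Normal_Form.Schur_Decomposition"
begin

unbundle no vec_syntax
no_notation Inner_Product.real_inner_class.inner (infix "\<bullet>" 70)

text \<open>
  A vector of length \<open>M\<close> over the complex numbers is a library \<open>complex vec\<close> of dimension \<open>M\<close>;
  the group of integers modulo \<open>M\<close> is represented by its residues \<open>{0..<M}\<close>.
  The inner product \<open>x \<bullet>c y\<close> is linear in the first and conjugate-linear in the second argument.
\<close>

definition l2_norm :: "complex vec \<Rightarrow> real" where
  "l2_norm x = sqrt (\<Sum>i<dim_vec x. (cmod (x $ i))\<^sup>2)"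

text \<open>For residues \<open>k < M\<close>, the index \<open>(m + (M - k)) mod M\<close> is \<open>m - k\<close> modulo \<open>M\<close>
  (on \<open>nat\<close>, plain \<open>m - k\<close> would truncate).\<close>

definition tf_shift :: "nat \<Rightarrow> nat \<times> nat \<Rightarrow> complex vec \<Rightarrow> complex vec" where
  "tf_shift M = (\<lambda>(k, l) x. Matrix.vec M
     (\<lambda>m. exp (2 * of_real pi * \<i> * of_nat l * of_nat m / of_nat M) * x $ ((m + (M - k)) mod M)))"

text \<open>The columns of a matrix carry an order, so \<open>\<Lambda>\<close> is listed lexicographically.\<close>

definition tf_list :: "nat \<Rightarrow> (nat \<times> nat) set \<Rightarrow> (nat \<times> nat) list" where
  "tf_list M \<Lambda> = filter (\<lambda>p. p \<in> \<Lambda>) (List.product [0..<M] [0..<M])"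

definition synthesis_mat :: "nat \<Rightarrow> (nat \<times> nat) set \<Rightarrow> complex vec \<Rightarrow> complex mat" where
  "synthesis_mat M \<Lambda> g = mat_of_cols M (map (\<lambda>p. tf_shift M p g) (tf_list M \<Lambda>))"

definition analysis_mat :: "nat \<Rightarrow> (nat \<times> nat) set \<Rightarrow> complex vec \<Rightarrow> complex mat" where
  "analysis_mat M \<Lambda> g = mat_adjoint (synthesis_mat M \<Lambda> g)"

text \<open>The square of the largest singular value of \<open>A\<close>. For a matrix with at least one column the
  supremum is a maximum; see \<open>sigma_max_sq_attained\<close>.\<close>

definition sigma_max_sq :: "complex mat \<Rightarrow> real" where
  "sigma_max_sq A = (SUP x\<in>{x \<in> carrier_vec (dim_col A). l2_norm x = 1}. (l2_norm (A *\<^sub>v x))\<^sup>2)"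

definition steinhaus_window :: "nat \<Rightarrow> (nat \<Rightarrow> real) \<Rightarrow> complex vec" where
  "steinhaus_window M y =
     Matrix.vec M (\<lambda>m. of_real (1 / sqrt (real M)) * exp (2 * of_real pi * \<i> * of_real (y m)))"

lemma l2_norm_sq: "(l2_norm x)\<^sup>2 = (\<Sum>i<dim_vec x. (cmod (x $ i))\<^sup>2)"
  by (simp add: l2_norm_def sum_nonneg)

lemma sigma_max_sq_attained:
  assumes "0 < dim_col A"
  shows "\<exists>x\<in>carrier_vec (dim_col A). l2_norm x = 1 \<and> sigma_max_sq A = (l2_norm (A *\<^sub>v x))\<^sup>2 \<and>
    (\<forall>z\<in>carrier_vec (dim_col A). l2_norm z = 1 \<longrightarrow> (l2_norm (A *\<^sub>v z))\<^sup>2 \<le> (l2_norm (A *\<^sub>v x))\<^sup>2)"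
proof -
  define n where "n = dim_col A"
  define F where "F = (\<lambda>f :: nat \<Rightarrow> complex.
    \<Sum>i<dim_row A. (cmod (\<Sum>j<n. A $$ (i, j) * f j))\<^sup>2)"
  define B where "B = (\<lambda>i. if i < n then cball (0::complex) 1 else {0})"
  define K where "K = PiE UNIV B \<inter> {f. (\<Sum>i<n. (cmod (f i))\<^sup>2) = 1}"
  have F_eq: "(l2_norm (A *\<^sub>v x))\<^sup>2 = F (\<lambda>j. if j < n then x $ j else 0)"
    if "x \<in> carrier_vec n" for x
  proof -
    have "(A *\<^sub>v x) $ i = (\<Sum>j<n. A $$ (i, j) * (if j < n then x $ j else 0))" if "i < dim_row A" for i
      using that \<open>x \<in> carrier_vec n\<close>
      by (auto simp: n_def scalar_prod_def lessThan_atLeast0 intro!: sum.cong)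
    then show ?thesis by (simp add: l2_norm_sq F_def)
  qed
  have cont_coord: "continuous_on UNIV (\<lambda>f :: nat \<Rightarrow> complex. f i)" for i
    by (rule continuous_on_product_coordinates)
  have comp: "compact K"
  proof -
    have "compactin (product_topology (\<lambda>_. euclidean) UNIV) (PiE UNIV B)"
      by (subst compactin_PiE) (auto simp: B_def)
    then have 1: "compact (PiE UNIV B)"
      by (simp add: euclidean_product_topology)
    have "closed {f :: nat \<Rightarrow> complex. (\<Sum>i<n. (cmod (f i))\<^sup>2) = 1}"
      by (intro closed_Collect_eq continuous_intros cont_coord)
    with 1 show ?thesis unfolding K_def by (rule compact_Int_closed)
  qed
  have contF: "continuous_on K F"
    unfolding F_def by (intro continuous_intros continuous_on_subset[OF cont_coord]) auto
  have "(\<lambda>i. if i = 0 then 1 else 0) \<in> K"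
  proof -
    have "(\<Sum>i<n. (cmod (if i = 0 then 1 else 0))\<^sup>2) = (\<Sum>i<n. if i = 0 then 1 else (0::real))"
      by (intro sum.cong) auto
    then show ?thesis using assms by (auto simp: K_def B_def n_def)
  qed
  then obtain f where f: "f \<in> K" "\<And>h. h \<in> K \<Longrightarrow> F h \<le> F f"
    using continuous_attains_sup[OF comp _ contF] by blast
  define x where "x = Matrix.vec n f"
  have x: "x \<in> carrier_vec n" by (simp add: x_def)
  have ext: "(\<lambda>j. if j < n then x $ j else 0) = f"
    using f(1) by (auto simp: K_def B_def x_def PiE_iff fun_eq_iff split: if_splits)
  have nx: "l2_norm x = 1" using f(1) by (simp add: l2_norm_def x_def K_def)
  have le: "(l2_norm (A *\<^sub>v z))\<^sup>2 \<le> (l2_norm (A *\<^sub>v x))\<^sup>2"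
    if z: "z \<in> carrier_vec n" and nz: "l2_norm z = 1" for z
  proof -
    have s: "(\<Sum>i<n. (cmod (z $ i))\<^sup>2) = 1"
      using l2_norm_sq[of z] nz z by simp
    have "cmod (z $ i) \<le> 1" if "i < n" for i
    proof -
      have "(cmod (z $ i))\<^sup>2 \<le> (\<Sum>i<n. (cmod (z $ i))\<^sup>2)"
        using that by (intro member_le_sum) auto
      then show ?thesis using s by (simp add: abs_square_le_1)
    qed
    then have "(\<lambda>j. if j < n then z $ j else 0) \<in> K"
      using s by (auto simp: K_def B_def)
    from f(2)[OF this] show ?thesis by (simp add: F_eq[OF z] F_eq[OF x] ext)
  qed
  have "sigma_max_sq A = (l2_norm (A *\<^sub>v x))\<^sup>2"
    unfolding sigma_max_sq_def n_def[symmetric]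
    by (rule cSup_eq_maximum) (use x nx le in auto)
  with x nx le show ?thesis by (auto simp: n_def)
qed

lemma sigma_max_sq_analysis_mat:
  assumes "\<Lambda> \<subseteq> {0..<M} \<times> {0..<M}"
  shows "sigma_max_sq (analysis_mat M \<Lambda> g) =
    (SUP x\<in>{x \<in> carrier_vec M. l2_norm x = 1}. \<Sum>p\<in>\<Lambda>. (cmod (x \<bullet>c tf_shift M p g))\<^sup>2)"
proof -
  let ?L = "tf_list M \<Lambda>"
  let ?A = "analysis_mat M \<Lambda> g"
  have L: "set ?L = \<Lambda>" "distinct ?L"
    using assms by (auto simp: tf_list_def distinct_product)
  have dims: "dim_col ?A = M" "dim_row ?A = length ?L"
    by (auto simp: analysis_mat_def synthesis_mat_def mat_adjoint_def)
  have "(l2_norm (?A *\<^sub>v x))\<^sup>2 = (\<Sum>p\<in>\<Lambda>. (cmod (x \<bullet>c tf_shift M p g))\<^sup>2)"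
    if x: "x \<in> carrier_vec M" for x
  proof -
    have tf: "tf_shift M p g \<in> carrier_vec M" for p
      by (cases p) (simp add: tf_shift_def)
    have "(?A *\<^sub>v x) $ i = x \<bullet>c tf_shift M (?L ! i) g" if i: "i < length ?L" for i
    proof -
      have "(?A *\<^sub>v x) $ i = row ?A i \<bullet> x"
        using i dims by simp
      also have "row ?A i = conjugate (tf_shift M (?L ! i) g)"
        using i tf
        by (simp add: analysis_mat_def synthesis_mat_def mat_adjoint_def)
      also have "\<dots> \<bullet> x = x \<bullet>c tf_shift M (?L ! i) g"
        using x tf by (intro comm_scalar_prod) auto
      finally show ?thesis .
    qed
    then have "(l2_norm (?A *\<^sub>v x))\<^sup>2 = (\<Sum>i<length ?L. (cmod (x \<bullet>c tf_shift M (?L ! i) g))\<^sup>2)"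
      by (simp add: l2_norm_sq dims)
    also have "\<dots> = (\<Sum>p\<in>\<Lambda>. (cmod (x \<bullet>c tf_shift M p g))\<^sup>2)"
      using sum.reindex_bij_betw[OF bij_betw_nth[OF L(2) refl refl]] L(1) by simp
    finally show ?thesis .
  qed
  then show ?thesis
    unfolding sigma_max_sq_def dims by (intro SUP_cong) auto
qed

end

theory Submission
  imports Defs
begin

text \<open>
  A Steinhaus window has entries of constant modulus, so the frame operator
  \<open>S = \<Phi>\<^sub>\<Lambda> \<Phi>\<^sub>\<Lambda>\<^sup>*\<close> has the deterministic diagonal \<open>card \<Lambda> / M\<close>, and its largest
  eigenvalue exceeds this by at most the Frobenius norm of the off-diagonal part. For
  \<open>m \<noteq> n\<close> the fourth moments of the window kill all pairs of shifts with distinct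
  translations in the expectation of \<open>(cmod (S m n))\<^sup>2\<close>. Summing the remaining characters over
  \<open>m \<noteq> n\<close>, the expected off-diagonal energy is \<open>card \<Lambda> - F / M\<close>, where \<open>F\<close> counts the pairs in
  \<open>\<Lambda>\<close> with equal translation, and \<open>F \<ge> (card \<Lambda>)\<^sup>2 / M\<close> by Cauchy--Schwarz. Markov's
  inequality concludes.
\<close>

section \<open>Moments of independent uniform phases\<close>

lemma cis_measurable [measurable]: "cis \<in> borel_measurable borel"
  unfolding cis_conv_exp by measurable

text \<open>For a nonzero integer frequency the antiderivative takes the same value at both ends of
  the unit interval.\<close>

lemma integral_cis_uniform:
  fixes n :: int
  assumes "n \<noteq> 0"
  shows "(\<integral>t. cis (2 * pi * of_int n * t) \<partial>uniform_measure lborel {0..<1}) = 0"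
proof -
  define c where "c = 2 * pi * real_of_int n"
  define F where "F = (\<lambda>t. cis (c * t) / (\<i> * of_real c))"
  have c: "c \<noteq> 0" using assms by (simp add: c_def)
  have "uniform_measure lborel {0..<1::real} = density lborel (\<lambda>t. ennreal (indicator {0..<1} t))"
    by (simp add: uniform_measure_def ennreal_indicator divide_ennreal_def)
  then have "(\<integral>t. cis (c * t) \<partial>uniform_measure lborel {0..<1})
      = (\<integral>t. indicator {0..<1} t *\<^sub>R cis (c * t) \<partial>lborel)"
    by (simp add: integral_density cis_conv_exp)
  \<comment> \<open>The fundamental theorem of calculus is applied on the closed interval, which
    differs from the half-open one only by the null set of the point 1.\<close>
  also have "\<dots> = (\<integral>t. indicator {0..1} t *\<^sub>R cis (c * t) \<partial>lborel)"
  proof (rule integral_cong_AE)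
    show "AE t in lborel. indicator {0..<1} t *\<^sub>R cis (c * t) = indicator {0..1} t *\<^sub>R cis (c * t)"
      by (rule eventually_mono[OF AE_lborel_singleton[of 1]]) (auto split: split_indicator)
  qed (simp_all add: cis_conv_exp)
  also have "\<dots> = F 1 - F 0"
  proof (rule integral_FTC_Icc)
    fix t :: real
    show "(F has_vector_derivative cis (c * t)) (at t within {0..1})"
      unfolding F_def cis_conv_exp of_real_mult
      by (rule has_vector_derivative_real_field[where f = "\<lambda>z. exp (\<i> * (of_real c * z)) / (\<i> * of_real c)"])
        (use c in \<open>auto intro!: derivative_eq_intros simp: mult_ac\<close>)
  qed (auto simp: cis_conv_exp intro!: continuous_intros)
  also have "F 1 = F 0"
    using cis_multiple_2pi[of "of_int n"] by (simp add: F_def c_def)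
  finally show ?thesis by (simp add: c_def)
qed

lemma prod_cis: "finite I \<Longrightarrow> (\<Prod>i\<in>I. cis (f i)) = cis (\<Sum>i\<in>I. f i)"
  by (induction rule: finite_induct) (simp_all add: cis_mult)

context prob_space
begin

text \<open>Independence factorises the expectation, and the single factor at \<open>j\<close>
  already vanishes.\<close>

lemma expectation_character:
  fixes Y :: "'i \<Rightarrow> 'a \<Rightarrow> real" and N :: "'i \<Rightarrow> int"
  assumes indep: "indep_vars (\<lambda>_. borel) Y I" and "finite I"
    and unif: "\<And>i. i \<in> I \<Longrightarrow> distr M lborel (Y i) = uniform_measure lborel {0..<1}"
    and "j \<in> I" "N j \<noteq> 0"
  shows "expectation (\<lambda>\<omega>. \<Prod>i\<in>I. cis (2 * pi * of_int (N i) * Y i \<omega>)) = 0"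
proof -
  have Y[measurable]: "Y i \<in> borel_measurable M" if "i \<in> I" for i
    using indep that by (auto simp: indep_vars_def)
  have "indep_vars (\<lambda>_. borel) (\<lambda>i \<omega>. cis (2 * pi * of_int (N i) * Y i \<omega>)) I"
    by (rule indep_vars_compose2[OF indep]) (simp add: cis_conv_exp)
  moreover have "integrable M (\<lambda>\<omega>. cis (2 * pi * of_int (N i) * Y i \<omega>))" if "i \<in> I" for i
    by (rule integrable_const_bound[of _ 1]) (use that in \<open>simp_all add: cis_conv_exp\<close>)
  ultimately have "expectation (\<lambda>\<omega>. \<Prod>i\<in>I. cis (2 * pi * of_int (N i) * Y i \<omega>)) =
      (\<Prod>i\<in>I. expectation (\<lambda>\<omega>. cis (2 * pi * of_int (N i) * Y i \<omega>)))"
    by (rule indep_vars_lebesgue_integral[OF \<open>finite I\<close>])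
  moreover have "expectation (\<lambda>\<omega>. cis (2 * pi * of_int (N j) * Y j \<omega>)) = 0"
  proof -
    have "expectation (\<lambda>\<omega>. cis (2 * pi * of_int (N j) * Y j \<omega>)) =
        (\<integral>t. cis (2 * pi * of_int (N j) * t) \<partial>distr M lborel (Y j))"
      using Y[OF \<open>j \<in> I\<close>] by (subst integral_distr) (simp_all add: cis_conv_exp)
    then show ?thesis
      using integral_cis_uniform[OF \<open>N j \<noteq> 0\<close>] unif[OF \<open>j \<in> I\<close>] by simp
  qed
  ultimately show ?thesis using \<open>j \<in> I\<close> \<open>finite I\<close> by (auto simp: prod_zero)
qed

text \<open>The four phases merge into one character with exponents \<open>N\<close>. Coincidences
  other than \<open>a = b\<close> and \<open>a = c\<close> are allowed, since exponents at the same
  index simply add up.\<close>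

lemma steinhaus_fourth_moment:
  fixes Y :: "'i \<Rightarrow> 'a \<Rightarrow> real"
  assumes indep: "indep_vars (\<lambda>_. borel) Y I" and "finite I"
    and unif: "\<And>i. i \<in> I \<Longrightarrow> distr M lborel (Y i) = uniform_measure lborel {0..<1}"
    and "a \<in> I" "b \<in> I" "c \<in> I" "d \<in> I" "a \<noteq> b" "a \<noteq> c"
  shows "expectation (\<lambda>\<omega>. cis (2 * pi * Y a \<omega>) * cnj (cis (2 * pi * Y b \<omega>)) *
    (cnj (cis (2 * pi * Y c \<omega>)) * cis (2 * pi * Y d \<omega>))) = 0"
proof -
  \<comment> \<open>\<open>N a \<noteq> 0\<close> also when \<open>d = a\<close>: the indicators of \<open>b\<close> and \<open>c\<close> vanish at \<open>a\<close>.\<close>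
  define N :: "'i \<Rightarrow> int" where
    "N i = of_bool (i = a) - of_bool (i = b) - of_bool (i = c) + of_bool (i = d)" for i
  have "cis (2 * pi * Y a \<omega>) * cnj (cis (2 * pi * Y b \<omega>)) *
      (cnj (cis (2 * pi * Y c \<omega>)) * cis (2 * pi * Y d \<omega>)) =
      (\<Prod>i\<in>I. cis (2 * pi * of_int (N i) * Y i \<omega>))" for \<omega>
  proof -
    have "(\<Sum>i\<in>I. 2 * pi * of_int (N i) * Y i \<omega>) =
        (\<Sum>i\<in>I. (if i = a then 2 * pi * Y i \<omega> else 0) - (if i = b then 2 * pi * Y i \<omega> else 0)
          - (if i = c then 2 * pi * Y i \<omega> else 0) + (if i = d then 2 * pi * Y i \<omega> else 0))"
      by (rule sum.cong) (auto simp: N_def algebra_simps)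
    also have "\<dots> = 2 * pi * Y a \<omega> - 2 * pi * Y b \<omega> - 2 * pi * Y c \<omega> + 2 * pi * Y d \<omega>"
      using assms by (simp add: sum.distrib sum_subtractf)
    finally have s: "(\<Sum>i\<in>I. 2 * pi * of_int (N i) * Y i \<omega>) =
        2 * pi * Y a \<omega> - 2 * pi * Y b \<omega> - 2 * pi * Y c \<omega> + 2 * pi * Y d \<omega>" .
    show ?thesis
      unfolding prod_cis[OF \<open>finite I\<close>] s by (simp add: cis_mult cis_cnj algebra_simps)
  qed
  moreover have "N a \<noteq> 0" using assms by (simp add: N_def)
  ultimately show ?thesis
    using expectation_character[OF indep \<open>finite I\<close> unif \<open>a \<in> I\<close>, of N] by simp
qed

text \<open>Markov's inequality, read for the complementary event.\<close>

lemma prob_le_of_expectation_le: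
  fixes X :: "'a \<Rightarrow> real"
  assumes [measurable]: "integrable M X" and nonneg: "\<And>\<omega>. 0 \<le> X \<omega>"
    and E: "expectation X \<le> T" and "0 < \<epsilon>"
  shows "prob {\<omega> \<in> space M. X \<omega> \<le> T / \<epsilon>} \<ge> 1 - \<epsilon>"
proof -
  have E0: "0 \<le> expectation X" by (rule Bochner_Integration.integral_nonneg) (rule nonneg)
  with E have "0 \<le> T" by simp
  show ?thesis
  proof (cases "T = 0")
    \<comment> \<open>Markov's inequality needs a positive threshold. If \<open>T = 0\<close>, the
      nonnegative \<open>X\<close> has mean zero and therefore vanishes almost surely.\<close>
    case True
    then have "expectation X = 0"
      using E E0 by simp
    then have "AE \<omega> in M. X \<omega> = 0"
      using integral_nonneg_eq_0_iff_AE[OF assms(1)] nonneg by simp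
    then have "prob {\<omega> \<in> space M. X \<omega> \<le> T / \<epsilon>} = 1"
      using True by (subst prob_eq_1) (auto elim: eventually_mono)
    then show ?thesis using \<open>0 < \<epsilon>\<close> by simp
  next
    case False
    with \<open>0 \<le> T\<close> \<open>0 < \<epsilon>\<close> have c: "0 < T / \<epsilon>" by simp
    have "prob {\<omega> \<in> space M. \<not> X \<omega> \<le> T / \<epsilon>} \<le> prob {\<omega> \<in> space M. T / \<epsilon> \<le> X \<omega>}"
      by (rule finite_measure_mono) auto
    also have "\<dots> \<le> expectation X / (T / \<epsilon>)"
      using c nonneg assms(1) by (intro integral_Markov_inequality_measure[where A = "space M"]) simp_all
    also have "\<dots> \<le> \<epsilon>"
      using E c \<open>0 < \<epsilon>\<close> \<open>0 \<le> T\<close> False by (simp add: field_simps)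
    finally have "prob {\<omega> \<in> space M. \<not> X \<omega> \<le> T / \<epsilon>} \<le> \<epsilon>" .
    moreover have "prob {\<omega> \<in> space M. \<not> X \<omega> \<le> T / \<epsilon>} = 1 - prob {\<omega> \<in> space M. X \<omega> \<le> T / \<epsilon>}"
      by (rule prob_neg) simp
    ultimately show ?thesis by simp
  qed
qed

end

section \<open>Character sums, fibre counting and quadratic forms\<close>

lemma sum_roots_of_unity_char:
  fixes a :: int
  assumes "0 < M" "\<bar>a\<bar> < int M"
  shows "(\<Sum>m<M. cis (2 * pi * of_int a * real m / real M)) = (if a = 0 then of_nat M else 0)"
proof (cases "a = 0")
  case False
  \<comment> \<open>The summands are the powers of an \<open>M\<close>-th root of unity
    \<open>z\<close>. Since \<open>z = 1\<close> would make \<open>a\<close> a multiple of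
    \<open>M\<close>, the bound on \<open>a\<close> leaves a vanishing geometric sum.\<close>
  define z where "z = cis (2 * pi * of_int a / real M)"
  have "z \<noteq> 1"
  proof
    assume "z = 1"
    then obtain n :: int where "2 * pi * of_int a / real M = of_int (2 * n) * pi"
      unfolding z_def cis_conv_exp exp_eq_1 by auto
    then have "real_of_int a = of_int n * real M"
      using assms by (simp add: field_simps)
    then have "a = n * int M" by (metis of_int_eq_iff of_int_mult of_int_of_nat_eq)
    with assms False show False
      by (metis abs_mult abs_of_nat dvd_imp_le_int dvd_triv_right linorder_not_le)
  qed
  moreover have "z ^ M = 1"
  proof -
    have "real M * (2 * pi * of_int a / real M) = 2 * pi * of_int a" using assms by simp
    then show ?thesis unfolding z_def Complex.DeMoivre by (simp only: cis_multiple_2pi Ints_of_int)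
  qed
  moreover have "cis (2 * pi * of_int a * real m / real M) = z ^ m" for m
    by (simp add: z_def Complex.DeMoivre mult_ac)
  ultimately show ?thesis using False by (simp add: geometric_sum)
qed simp

text \<open>The full double sum factors into the character sums for \<open>a\<close> and
  \<open>-a\<close>; each of the \<open>M\<close> diagonal terms removed from it equals 1.\<close>

lemma sum_off_diagonal_char:
  fixes a :: int
  assumes "0 < M" "\<bar>a\<bar> < int M"
  shows "(\<Sum>m<M. \<Sum>n\<in>{..<M}-{m}. cis (2 * pi * of_int a * (real m - real n) / real M)) =
    (if a = 0 then (of_nat M)\<^sup>2 else 0) - of_nat M"
proof -
  let ?e = "\<lambda>m n. cis (2 * pi * of_int a * (real m - real n) / real M)"
  have e: "?e m n = cis (2 * pi * of_int a * real m / real M) * cis (2 * pi * of_int (-a) * real n / real M)" for m n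
    by (simp add: cis_mult right_diff_distrib diff_divide_distrib)
  have "(\<Sum>n\<in>{..<M}-{m}. ?e m n) = (\<Sum>n<M. ?e m n) - 1" if "m < M" for m
    using that by (subst sum.remove[of _ m]) simp_all
  then have "(\<Sum>m<M. \<Sum>n\<in>{..<M}-{m}. ?e m n) = (\<Sum>m<M. \<Sum>n<M. ?e m n) - of_nat M"
    by (simp add: sum_subtractf)
  also have "(\<Sum>m<M. \<Sum>n<M. ?e m n) = (if a = 0 then (of_nat M)\<^sup>2 else 0)"
    unfolding e sum_product[symmetric]
    using sum_roots_of_unity_char[OF assms] sum_roots_of_unity_char[of M "-a"] assms
    by (simp add: power2_eq_square)
  finally show ?thesis .
qed

text \<open>With \<open>N k\<close> the size of the fibre over \<open>k\<close>, the sum of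
  \<open>N k\<close> is \<open>card \<Lambda>\<close> and the sum of its squares counts the pairs in
  a common fibre. Cauchy-Schwarz against the constant 1 compares the two.\<close>

lemma card_sq_le_fibre_pairs:
  fixes \<Lambda> :: "(nat \<times> 'b) set"
  assumes "finite \<Lambda>" "fst ` \<Lambda> \<subseteq> {..<M}"
  shows "(real (card \<Lambda>))\<^sup>2 \<le> real M * (\<Sum>p\<in>\<Lambda>. \<Sum>q\<in>\<Lambda>. of_bool (fst p = fst q))"
proof -
  define N where "N k = (\<Sum>p\<in>\<Lambda>. of_bool (fst p = k) :: real)" for k
  have "(\<Sum>k<M. N k) = (\<Sum>p\<in>\<Lambda>. \<Sum>k<M. of_bool (fst p = k))"
    unfolding N_def by (rule sum.swap)
  also have "\<dots> = (\<Sum>p\<in>\<Lambda>. 1)"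
    using assms(2) by (intro sum.cong) (auto simp: of_bool_def)
  finally have 1: "real (card \<Lambda>) = (\<Sum>k<M. N k * 1)" by simp
  have "(\<Sum>k<M. (N k)\<^sup>2) = (\<Sum>k<M. \<Sum>p\<in>\<Lambda>. \<Sum>q\<in>\<Lambda>. of_bool (fst p = k) * of_bool (fst q = k))"
    by (simp add: N_def power2_eq_square sum_product)
  also have "\<dots> = (\<Sum>p\<in>\<Lambda>. \<Sum>q\<in>\<Lambda>. \<Sum>k<M. of_bool (fst p = k) * of_bool (fst q = k))"
    by (subst sum.swap) (intro sum.cong refl sum.swap)
  also have "\<dots> = (\<Sum>p\<in>\<Lambda>. \<Sum>q\<in>\<Lambda>. of_bool (fst p = fst q))"
  proof (intro sum.cong refl)
    fix p q assume "p \<in> \<Lambda>" "q \<in> \<Lambda>"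
    have "(\<Sum>k<M. of_bool (fst p = k) * of_bool (fst q = k)) =
        (\<Sum>k<M. if k = fst p then of_bool (fst p = fst q) else (0::real))"
      by (intro sum.cong) auto
    then show "(\<Sum>k<M. of_bool (fst p = k) * of_bool (fst q = k)) = (of_bool (fst p = fst q) :: real)"
      using \<open>p \<in> \<Lambda>\<close> assms(2) by (auto simp:)
  qed
  finally have 2: "(\<Sum>k<M. (N k)\<^sup>2) = (\<Sum>p\<in>\<Lambda>. \<Sum>q\<in>\<Lambda>. of_bool (fst p = fst q))" .
  show ?thesis
    using Cauchy_Schwarz_ineq_sum[of N "\<lambda>_. 1" "{..<M}"] unfolding 1 2 by (simp add: mult.commute)
qed

text \<open>The diagonal contributes exactly \<open>D\<close> because \<open>x\<close> is a unit
  vector. The rest is a pairing of the products of entries of \<open>x\<close> with the off-diagonal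
  entries of \<open>S\<close>, to which Cauchy-Schwarz applies.\<close>

lemma hermitian_form_le_diag_plus_frobenius:
  fixes x :: "nat \<Rightarrow> complex" and S :: "nat \<Rightarrow> nat \<Rightarrow> complex"
  assumes x: "(\<Sum>m<M. (cmod (x m))\<^sup>2) = 1" and S: "\<And>m. m < M \<Longrightarrow> S m m = of_real D"
  shows "Re (\<Sum>m<M. \<Sum>n<M. cnj (x m) * x n * S m n)
    \<le> D + sqrt (\<Sum>m<M. \<Sum>n\<in>{..<M}-{m}. (cmod (S m n))\<^sup>2)"
proof -
  let ?O = "Sigma {..<M} (\<lambda>m. {..<M} - {m})"
  define R where "R = (\<Sum>m<M. \<Sum>n\<in>{..<M}-{m}. cnj (x m) * x n * S m n)"
  have "(\<Sum>m<M. \<Sum>n<M. cnj (x m) * x n * S m n) = (\<Sum>m<M. cnj (x m) * x m * of_real D) + R"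
    unfolding R_def sum.distrib[symmetric]
    by (rule sum.cong) (use S in \<open>simp_all add: sum.remove\<close>)
  also have "(\<Sum>m<M. cnj (x m) * x m * of_real D) = of_real ((\<Sum>m<M. (cmod (x m))\<^sup>2) * D)"
    unfolding of_real_mult of_real_sum complex_norm_square sum_distrib_right
    by (simp add: mult.commute)
  finally have "Re (\<Sum>m<M. \<Sum>n<M. cnj (x m) * x n * S m n) = D + Re R" by (simp add: x)
  moreover have "cmod R \<le> sqrt (\<Sum>m<M. \<Sum>n\<in>{..<M}-{m}. (cmod (S m n))\<^sup>2)"
  proof -
    have "cmod R \<le> (\<Sum>(m, n)\<in>?O. \<bar>cmod (x m) * cmod (x n)\<bar> * \<bar>cmod (S m n)\<bar>)"
      unfolding R_def by (subst sum.Sigma) (auto intro!: sum_norm_le simp: norm_mult)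
    also have "\<dots> \<le> L2_set (\<lambda>(m, n). cmod (x m) * cmod (x n)) ?O * L2_set (\<lambda>(m, n). cmod (S m n)) ?O"
      using L2_set_mult_ineq[of "\<lambda>(m, n). cmod (x m) * cmod (x n)" "\<lambda>(m, n). cmod (S m n)" ?O]
      by (simp add: case_prod_unfold)
    also have "L2_set (\<lambda>(m, n). cmod (x m) * cmod (x n)) ?O \<le> 1"
    proof -
      \<comment> \<open>Adding the diagonal pairs back turns the sum into a product of two squared
        norms, both equal to 1.\<close>
      have "(\<Sum>(m, n)\<in>?O. (cmod (x m) * cmod (x n))\<^sup>2)
          \<le> (\<Sum>(m, n)\<in>{..<M} \<times> {..<M}. (cmod (x m) * cmod (x n))\<^sup>2)"
        by (rule sum_mono2) auto
      also have "\<dots> = (\<Sum>m<M. (cmod (x m))\<^sup>2) * (\<Sum>n<M. (cmod (x n))\<^sup>2)"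
        by (simp add: sum_product sum.cartesian_product power_mult_distrib)
      finally show ?thesis by (simp add: L2_set_def x case_prod_unfold)
    qed
    also have "1 * L2_set (\<lambda>(m, n). cmod (S m n)) ?O = sqrt (\<Sum>m<M. \<Sum>n\<in>{..<M}-{m}. (cmod (S m n))\<^sup>2)"
      by (simp add: L2_set_def sum.Sigma case_prod_unfold)
    finally show ?thesis by (simp add: mult_right_mono)
  qed
  ultimately show ?thesis using complex_Re_le_cmod[of R] by linarith
qed

section \<open>Shifted Steinhaus windows and their frame operator\<close>

lemma cyclic_shift_eq_iff:
  fixes M :: nat
  assumes "k < M" "k' < M" "m < M"
  shows "(m + (M - k)) mod M = (m + (M - k')) mod M \<longleftrightarrow> k = k'"
proof -
  \<comment> \<open>The argument is below \<open>2 * M\<close>, so reducing it takes at most one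
    subtraction of \<open>M\<close>.\<close>
  have "(m + (M - j)) mod M = (if j \<le> m then m - j else m + M - j)" if "j < M" for j
    using that assms(3) by (auto simp: mod_if)
  then show ?thesis using assms by auto
qed

lemma cyclic_shift_inj:
  fixes M :: nat
  assumes "k < M" "m < M" "n < M"
  shows "(m + (M - k)) mod M = (n + (M - k)) mod M \<longleftrightarrow> m = n"
proof -
  have "(j + (M - k)) mod M = (if k \<le> j then j - k else j + M - k)" if "j < M" for j
    using that assms(1) by (auto simp: mod_if)
  then show ?thesis using assms by auto
qed

text \<open>Separates the deterministic character from the random phase. In terms of
  \<open>cis\<close>, products and conjugates become arithmetic of phases.\<close>

lemma tf_shift_steinhaus:
  assumes "m < M"
  shows "tf_shift M p (steinhaus_window M y) $ m =
    of_real (1 / sqrt (real M)) * cis (2 * pi * real (snd p) * real m / real M) *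
    cis (2 * pi * y ((m + (M - fst p)) mod M))"
proof -
  have "cis (2 * pi * real (snd p) * real m / real M) =
      exp (2 * of_real pi * \<i> * of_nat (snd p) * of_nat m / of_nat M)"
    and "cis (2 * pi * t) = exp (2 * of_real pi * \<i> * of_real t)" for t
    by (simp_all add: cis_conv_exp mult_ac)
  then show ?thesis
    using assms by (simp add: tf_shift_def steinhaus_window_def split_beta)
qed

text \<open>For \<open>\<Lambda>\<close> inside the grid these are the entries of
  \<open>synthesis_mat M \<Lambda> g * analysis_mat M \<Lambda> g\<close>, indexed by plain numbers
  so that finite sums can be manipulated directly.\<close>

definition frame_entry :: "nat \<Rightarrow> (nat \<times> nat) set \<Rightarrow> complex vec \<Rightarrow> nat \<Rightarrow> nat \<Rightarrow> complex" where
  "frame_entry M \<Lambda> g m n = (\<Sum>p\<in>\<Lambda>. tf_shift M p g $ m * cnj (tf_shift M p g $ n))"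

text \<open>The squared Frobenius norm of the frame operator with its diagonal removed.\<close>

definition off_diag_energy :: "nat \<Rightarrow> (nat \<times> nat) set \<Rightarrow> complex vec \<Rightarrow> real" where
  "off_diag_energy M \<Lambda> g = (\<Sum>m<M. \<Sum>n\<in>{..<M}-{m}. (cmod (frame_entry M \<Lambda> g m n))\<^sup>2)"

text \<open>Expand each squared modulus and sum over \<open>\<Lambda>\<close> first. The form is
  already real; \<open>Re\<close> only moves it to the type \<open>real\<close>.\<close>

lemma analysis_energy_eq_frame_form:
  assumes x: "x \<in> carrier_vec M"
  shows "(\<Sum>p\<in>\<Lambda>. (cmod (x \<bullet>c tf_shift M p g))\<^sup>2) =
    Re (\<Sum>m<M. \<Sum>n<M. cnj (x $ m) * x $ n * frame_entry M \<Lambda> g m n)"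
proof -
  have ip: "x \<bullet>c tf_shift M p g = (\<Sum>m<M. x $ m * cnj (tf_shift M p g $ m))" for p
  proof -
    have "dim_vec (tf_shift M p g) = M" by (simp add: tf_shift_def split_beta)
    then show ?thesis by (simp add: scalar_prod_def lessThan_atLeast0)
  qed
  have "complex_of_real (\<Sum>p\<in>\<Lambda>. (cmod (x \<bullet>c tf_shift M p g))\<^sup>2) =
      (\<Sum>p\<in>\<Lambda>. \<Sum>m<M. \<Sum>n<M. cnj (x $ m) * x $ n * (tf_shift M p g $ m * cnj (tf_shift M p g $ n)))"
    unfolding of_real_sum complex_norm_square ip cnj_sum sum_product
    by (rule sum.cong[OF refl], subst sum.swap) (simp add: mult_ac)
  also have "\<dots> = (\<Sum>m<M. \<Sum>n<M. cnj (x $ m) * x $ n * frame_entry M \<Lambda> g m n)"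
    unfolding frame_entry_def sum_distrib_left
    by (subst sum.swap) (intro sum.cong refl sum.swap)
  finally show ?thesis by (metis Re_complex_of_real)
qed

lemma analysis_energy_le:
  assumes "0 < M" and x: "x \<in> carrier_vec M" "l2_norm x = 1"
  shows "(\<Sum>p\<in>\<Lambda>. (cmod (x \<bullet>c tf_shift M p (steinhaus_window M y)))\<^sup>2)
    \<le> real (card \<Lambda>) / real M + sqrt (off_diag_energy M \<Lambda> (steinhaus_window M y))"
  unfolding analysis_energy_eq_frame_form[OF x(1)] off_diag_energy_def
proof (rule hermitian_form_le_diag_plus_frobenius)
  show "(\<Sum>m<M. (cmod (x $ m))\<^sup>2) = 1" using l2_norm_sq[of x] x by simp
next
  fix m assume "m < M"
  \<comment> \<open>Translation and modulation preserve the constant modulus of the window, so every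
    shift contributes the same amount to the diagonal, whatever the phases are.\<close>
  have "tf_shift M p (steinhaus_window M y) $ m * cnj (tf_shift M p (steinhaus_window M y) $ m)
      = of_real (1 / real M)" for p
    unfolding complex_norm_square[symmetric] tf_shift_steinhaus[OF \<open>m < M\<close>]
    using \<open>0 < M\<close> by (simp add: norm_mult norm_divide power_divide)
  then show "frame_entry M \<Lambda> (steinhaus_window M y) m m = of_real (real (card \<Lambda>) / real M)"
    by (simp add: frame_entry_def)
qed

text \<open>Replaces the supremum by a condition on each unit vector, used both for measurability
  and for the final estimate. The sphere is nonempty because \<open>0 < M\<close>, and
  \<open>analysis_energy_le\<close> bounds the supremum.\<close>

lemma sigma_max_sq_analysis_le_iff:
  assumes "0 < M" "\<Lambda> \<subseteq> {0..<M} \<times> {0..<M}"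
  shows "sigma_max_sq (analysis_mat M \<Lambda> (steinhaus_window M y)) \<le> c \<longleftrightarrow>
    (\<forall>x\<in>{x \<in> carrier_vec M. l2_norm x = 1}.
      (\<Sum>p\<in>\<Lambda>. (cmod (x \<bullet>c tf_shift M p (steinhaus_window M y)))\<^sup>2) \<le> c)"
  unfolding sigma_max_sq_analysis_mat[OF assms(2)]
proof (rule cSUP_le_iff)
  have "l2_norm (unit_vec M 0) = sqrt (\<Sum>i<M. if i = 0 then 1 else 0)"
    unfolding l2_norm_def by (intro arg_cong[where f = sqrt] sum.cong) (auto simp: unit_vec_def)
  then have "unit_vec M 0 \<in> {x \<in> carrier_vec M. l2_norm x = 1}"
    using assms(1) by simp
  then show "{x \<in> carrier_vec M. l2_norm x = 1} \<noteq> {}" by blast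
qed (use analysis_energy_le[OF assms(1)] in \<open>auto intro!: bdd_aboveI2\<close>)

text \<open>Measurability matters because \<open>measure\<close> is 0 on non-measurable sets. The supremum is over an
  uncountable sphere, but its sublevel sets are closed as sets of phase sequences.\<close>

lemma sets_sigma_max_sq_le:
  fixes Y :: "nat \<Rightarrow> 'a \<Rightarrow> real"
  assumes "0 < M" "\<Lambda> \<subseteq> {0..<M} \<times> {0..<M}" and Y: "\<And>m. m < M \<Longrightarrow> Y m \<in> borel_measurable N"
  shows "{\<omega> \<in> space N. sigma_max_sq (analysis_mat M \<Lambda> (steinhaus_window M (\<lambda>m. Y m \<omega>))) \<le> c} \<in> sets N"
proof -
  let ?X = "{x \<in> carrier_vec M. l2_norm x = 1}"
  let ?f = "\<lambda>x y. \<Sum>p\<in>\<Lambda>. (cmod (x \<bullet>c tf_shift M p (steinhaus_window M y)))\<^sup>2"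
  define C where "C = (\<Inter>x\<in>?X. {y :: nat \<Rightarrow> real. ?f x y \<le> c})"
  \<comment> \<open>Only the coordinates below \<open>M\<close> are known to be measurable. Setting
    the others to 0 gives a measurable map into the full product space without changing the
    window.\<close>
  define Z where "Z = (\<lambda>\<omega> m. if m < M then Y m \<omega> else 0)"
  have "continuous_on UNIV (?f x)" if x: "x \<in> ?X" for x
  proof -
    have "x \<bullet>c tf_shift M p (steinhaus_window M y) = (\<Sum>m<M. x $ m * cnj (
        of_real (1 / sqrt (real M)) * cis (2 * pi * real (snd p) * real m / real M) *
        cis (2 * pi * y ((m + (M - fst p)) mod M))))" for p y
    proof -
      have "dim_vec (tf_shift M p (steinhaus_window M y)) = M" by (simp add: tf_shift_def split_beta)
      then show ?thesis
        by (simp add: scalar_prod_def lessThan_atLeast0 tf_shift_steinhaus)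
    qed
    then show ?thesis
      by (simp only: cis_conv_exp) (intro continuous_intros continuous_on_product_coordinates)
  qed
  then have [measurable]: "C \<in> sets borel"
    unfolding C_def by (intro borel_closed closed_INT ballI closed_Collect_le continuous_on_const) auto
  have [measurable]: "Z \<in> borel_measurable N"
      proof (rule measurable_coordinatewise_then_product)
    show "(\<lambda>\<omega>. Z \<omega> i) \<in> borel_measurable N" for i
      using Y by (cases "i < M") (simp_all add: Z_def)
  qed

  have "{\<omega> \<in> space N. Z \<omega> \<in> C} \<in> sets N" by measurable
  moreover have "steinhaus_window M (Z \<omega>) = steinhaus_window M (\<lambda>m. Y m \<omega>)" for \<omega>
    by (auto simp: steinhaus_window_def Z_def)
  ultimately show ?thesis
    by (simp add: sigma_max_sq_analysis_le_iff[OF assms(1,2)] C_def)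
qed

section \<open>Expected off-diagonal energy\<close>

context prob_space
begin

text \<open>For \<open>k = k'\<close> the phases cancel pointwise. Otherwise the index
  \<open>m - k\<close> modulo \<open>N\<close> differs from \<open>n - k\<close> and from
  \<open>m - k'\<close>, so the fourth moment vanishes. The form \<open>has_bochner_integral\<close>
  carries integrability and value through finite sums together.\<close>

lemma steinhaus_product_has_integral:
  fixes Y :: "nat \<Rightarrow> 'a \<Rightarrow> real"
  assumes indep: "indep_vars (\<lambda>_. borel) Y {0..<N}"
    and unif: "\<And>i. i < N \<Longrightarrow> distr M lborel (Y i) = uniform_measure lborel {0..<1}"
    and k: "k < N" "k' < N" and m: "m < N" "n < N" "m \<noteq> n"
  defines "u \<equiv> \<lambda>i \<omega>. cis (2 * pi * Y i \<omega>)"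
  shows "has_bochner_integral M (\<lambda>\<omega>.
    u ((m + (N - k)) mod N) \<omega> * cnj (u ((n + (N - k)) mod N) \<omega>) *
    (cnj (u ((m + (N - k')) mod N) \<omega>) * u ((n + (N - k')) mod N) \<omega>)) (of_bool (k = k'))"
    (is "has_bochner_integral M ?H _")
proof (cases "k = k'")
  case True
  have "cis t * cnj (cis s) * (cnj (cis t) * cis s) = 1" for s t
    by (simp add: cis_cnj cis_mult)
  then have "?H = (\<lambda>_. 1)" using True by (auto simp: u_def)
  then show ?thesis using True by (simp add: has_bochner_integral_iff prob_space)
next
  case False
  have mod: "j mod N < N" for j using m by simp
  have [measurable]: "Y i \<in> borel_measurable M" if "i < N" for i
    using indep that by (auto simp: indep_vars_def)
  have "integrable M ?H"
    by (rule integrable_const_bound[of _ 1]) (use mod in \<open>simp_all add: u_def cis_cnj cis_mult\<close>)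
  moreover have "expectation ?H = 0"
    unfolding u_def
    by (rule steinhaus_fourth_moment[OF indep])
      (use unif mod False m(3) cyclic_shift_eq_iff[OF k m(1)] cyclic_shift_inj[OF k(1) m(1,2)] in simp_all)
  ultimately show ?thesis using False by (simp add: has_bochner_integral_iff)
qed

text \<open>Expanding the squared modulus over pairs \<open>p\<close>, \<open>q\<close> leaves a
  constant \<open>K p q\<close> times a product of four phases. The integral is complex because the
  individual terms need not be real.\<close>

lemma frame_entry_sq_has_integral:
  fixes Y :: "nat \<Rightarrow> 'a \<Rightarrow> real"
  assumes indep: "indep_vars (\<lambda>_. borel) Y {0..<N}"
    and unif: "\<And>i. i < N \<Longrightarrow> distr M lborel (Y i) = uniform_measure lborel {0..<1}"
    and \<Lambda>: "\<Lambda> \<subseteq> {0..<N} \<times> {0..<N}" and m: "m < N" "n < N" "m \<noteq> n"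
  shows "has_bochner_integral M
    (\<lambda>\<omega>. complex_of_real ((cmod (frame_entry N \<Lambda> (steinhaus_window N (\<lambda>i. Y i \<omega>)) m n))\<^sup>2))
    (\<Sum>p\<in>\<Lambda>. \<Sum>q\<in>\<Lambda>. cis (2 * pi * of_int (int (snd p) - int (snd q)) * (real m - real n) / real N) /
      (of_nat N)\<^sup>2 * of_bool (fst p = fst q))"
proof -
  define u where "u = (\<lambda>i \<omega>. cis (2 * pi * Y i \<omega>))"
  define s where "s = (\<lambda>(p :: nat \<times> nat) m. (m + (N - fst p)) mod N)"
  define K where "K p q = cis (2 * pi * of_int (int (snd p) - int (snd q)) * (real m - real n) / real N) /
      (of_nat N :: complex)\<^sup>2" for p q :: "nat \<times> nat"
  have expand: "complex_of_real ((cmod (frame_entry N \<Lambda> (steinhaus_window N (\<lambda>i. Y i \<omega>)) m n))\<^sup>2) =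
      (\<Sum>p\<in>\<Lambda>. \<Sum>q\<in>\<Lambda>. K p q * (u (s p m) \<omega> * cnj (u (s p n) \<omega>) *
        (cnj (u (s q m) \<omega>) * u (s q n) \<omega>)))" for \<omega>
    unfolding complex_norm_square frame_entry_def cnj_sum sum_product
  proof (intro sum.cong refl)
    fix p q :: "nat \<times> nat"
    let ?g = "steinhaus_window N (\<lambda>i. Y i \<omega>)"
    define E where "E = (\<lambda>(p :: nat \<times> nat) m. cis (2 * pi * real (snd p) * real m / real N))"
    define r where "r = complex_of_real (1 / sqrt (real N))"
    have tf: "tf_shift N p ?g $ j = r * E p j * u (s p j) \<omega>" if "j < N" for j p
      using that by (simp add: tf_shift_steinhaus r_def E_def u_def s_def)
    \<comment> \<open>Each of the four window entries contributes one normalising factor.\<close>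
    have "r ^ 4 = of_real ((1 / sqrt (real N)) ^ 4)" by (simp add: r_def)
    also have "(1 / sqrt (real N)) ^ 4 = 1 / (real N)\<^sup>2"
      using power_mult[of "sqrt (real N)" 2 2] by (simp add: power_divide)
    finally have r: "r ^ 4 = 1 / (of_nat N)\<^sup>2" by simp
    have "E p m * cnj (E p n) * (cnj (E q m) * E q n) =
        cis (2 * pi * of_int (int (snd p) - int (snd q)) * (real m - real n) / real N)"
      by (simp add: E_def cis_mult cis_cnj diff_divide_distrib add_divide_distrib algebra_simps)
    then have K: "K p q = r ^ 4 * (E p m * cnj (E p n) * (cnj (E q m) * E q n))"
      by (simp add: K_def r)
    have "cnj r = r" by (simp add: r_def)
    then show "tf_shift N p ?g $ m * cnj (tf_shift N p ?g $ n) *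
        cnj (tf_shift N q ?g $ m * cnj (tf_shift N q ?g $ n)) =
        K p q * (u (s p m) \<omega> * cnj (u (s p n) \<omega>) * (cnj (u (s q m) \<omega>) * u (s q n) \<omega>))"
      unfolding K using m by (simp add: tf power4_eq_xxxx mult_ac)
  qed
  show ?thesis
    unfolding expand K_def[symmetric]
  proof (intro has_bochner_integral_sum has_bochner_integral_mult_right)
    fix p q assume "p \<in> \<Lambda>" "q \<in> \<Lambda>"
    then have "fst p < N" "fst q < N" using \<Lambda> by auto
    from steinhaus_product_has_integral[OF indep unif this m]
    show "has_bochner_integral M (\<lambda>\<omega>. u (s p m) \<omega> * cnj (u (s p n) \<omega>) *
        (cnj (u (s q m) \<omega>) * u (s q n) \<omega>)) (of_bool (fst p = fst q))"
      by (simp add: u_def s_def)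
  qed
qed

text \<open>Exchanging the sums lets the character sum over \<open>m \<noteq> n\<close> be evaluated
  for each pair of shifts; what remains is a count of pairs with equal translation.\<close>

lemma off_diag_energy_expectation:
  fixes Y :: "nat \<Rightarrow> 'a \<Rightarrow> real"
  assumes "0 < N" and indep: "indep_vars (\<lambda>_. borel) Y {0..<N}"
    and unif: "\<And>i. i < N \<Longrightarrow> distr M lborel (Y i) = uniform_measure lborel {0..<1}"
    and \<Lambda>: "\<Lambda> \<subseteq> {0..<N} \<times> {0..<N}"
  defines "X \<equiv> \<lambda>\<omega>. off_diag_energy N \<Lambda> (steinhaus_window N (\<lambda>i. Y i \<omega>))"
  shows "integrable M X"
    and "expectation X \<le> real (card \<Lambda>) * (1 - real (card \<Lambda>) / (real N)\<^sup>2)"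
proof -
  let ?e = "\<lambda>p q m n. cis (2 * pi * of_int (int (snd p) - int (snd q)) * (real m - real n) / real N)"
  define F where "F = (\<Sum>p\<in>\<Lambda>. \<Sum>q\<in>\<Lambda>. of_bool (fst p = fst q) :: real)"
  have fin: "finite \<Lambda>" using \<Lambda> by (rule finite_subset) simp
  have "has_bochner_integral M (\<lambda>\<omega>. complex_of_real (X \<omega>))
      (\<Sum>m<N. \<Sum>n\<in>{..<N}-{m}. \<Sum>p\<in>\<Lambda>. \<Sum>q\<in>\<Lambda>. ?e p q m n / (of_nat N)\<^sup>2 * of_bool (fst p = fst q))"
    unfolding X_def off_diag_energy_def of_real_sum
    by (intro has_bochner_integral_sum frame_entry_sq_has_integral[OF indep unif \<Lambda>]) auto
  also have "(\<Sum>m<N. \<Sum>n\<in>{..<N}-{m}. \<Sum>p\<in>\<Lambda>. \<Sum>q\<in>\<Lambda>. ?e p q m n / (of_nat N)\<^sup>2 * of_bool (fst p = fst q)) =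
      (\<Sum>m<N. \<Sum>p\<in>\<Lambda>. \<Sum>q\<in>\<Lambda>. \<Sum>n\<in>{..<N}-{m}. ?e p q m n / (of_nat N)\<^sup>2 * of_bool (fst p = fst q))"
    by (rule sum.cong[OF refl], subst sum.swap, rule sum.cong[OF refl], rule sum.swap)
  also have "\<dots> = (\<Sum>p\<in>\<Lambda>. \<Sum>q\<in>\<Lambda>. \<Sum>m<N. \<Sum>n\<in>{..<N}-{m}. ?e p q m n / (of_nat N)\<^sup>2 * of_bool (fst p = fst q))"
    by (subst sum.swap, rule sum.cong[OF refl], rule sum.swap)
  \<comment> \<open>A pair contributes \<open>1 - 1 / N\<close> if \<open>p = q\<close>,
    \<open>- 1 / N\<close> if only the translations agree, and 0 otherwise.\<close>
  also have "\<dots> = (\<Sum>p\<in>\<Lambda>. \<Sum>q\<in>\<Lambda>. of_bool (p = q) - of_bool (fst p = fst q) / of_nat N)"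
  proof (intro sum.cong refl)
    fix p q assume "p \<in> \<Lambda>" "q \<in> \<Lambda>"
    then have "snd p < N" "snd q < N" using \<Lambda> by auto
    then have a: "\<bar>int (snd p) - int (snd q)\<bar> < int N" by linarith
    have "(\<Sum>m<N. \<Sum>n\<in>{..<N}-{m}. ?e p q m n / (of_nat N)\<^sup>2 * of_bool (fst p = fst q)) =
        ((if int (snd p) - int (snd q) = 0 then (of_nat N)\<^sup>2 else 0) - of_nat N) / (of_nat N)\<^sup>2 * of_bool (fst p = fst q)"
      unfolding sum_off_diagonal_char[OF \<open>0 < N\<close> a, symmetric] by (simp add: sum_divide_distrib sum_distrib_right)
    also have "\<dots> = of_bool (p = q) - of_bool (fst p = fst q) / of_nat N"
      using \<open>0 < N\<close> by (auto simp: prod_eq_iff diff_divide_distrib power2_eq_square)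
    finally show "(\<Sum>m<N. \<Sum>n\<in>{..<N}-{m}. ?e p q m n / (of_nat N)\<^sup>2 * of_bool (fst p = fst q)) =
        of_bool (p = q) - of_bool (fst p = fst q) / of_nat N" .
  qed
  also have "\<dots> = complex_of_real (real (card \<Lambda>) - F / real N)"
    using fin by (simp add: F_def sum_subtractf sum_divide_distrib of_bool_def)
      (intro sum.cong refl, simp)
  finally have *: "has_bochner_integral M X (real (card \<Lambda>) - F / real N)"
    using has_bochner_integral_Re by fastforce
  then show "integrable M X" by (simp add: has_bochner_integral_iff)
  \<comment> \<open>\<open>F\<close> enters the expectation with a negative sign, so its lower bound
    gives an upper bound.\<close>
  have "(real (card \<Lambda>))\<^sup>2 \<le> real N * F"
    unfolding F_def by (rule card_sq_le_fibre_pairs[OF fin]) (use \<Lambda> in auto)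
  then have "real (card \<Lambda>) - F / real N \<le> real (card \<Lambda>) * (1 - real (card \<Lambda>) / (real N)\<^sup>2)"
    using \<open>0 < N\<close> by (simp add: field_simps power2_eq_square)
  then show "expectation X \<le> real (card \<Lambda>) * (1 - real (card \<Lambda>) / (real N)\<^sup>2)"
    using * by (simp add: has_bochner_integral_iff)
qed

end

section \<open>From the expected energy to the probability bound\<close>

theorem theorem2p2:
  fixes M :: nat and P :: "'w measure" and y :: "nat \<Rightarrow> 'w \<Rightarrow> real"
    and \<Lambda> :: "(nat \<times> nat) set" and \<epsilon> :: real
  assumes "1 \<le> M"
    and "prob_space P"
    and "prob_space.indep_vars P (\<lambda>_. borel) y {0..<M}"
    and "\<And>m. m < M \<Longrightarrow> distr P lborel (y m) = uniform_measure lborel {0..<1}"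
    and "\<Lambda> \<subseteq> {0..<M} \<times> {0..<M}"
    and "0 < \<epsilon>" and "\<epsilon> < 1"
  shows "measure P {\<omega> \<in> space P.
      sigma_max_sq (analysis_mat M \<Lambda> (steinhaus_window M (\<lambda>m. y m \<omega>)))
        \<le> real (card \<Lambda>) / real M
          + sqrt (real (card \<Lambda>) / \<epsilon> * (1 - real (card \<Lambda>) / (real M)\<^sup>2))} \<ge> 1 - \<epsilon>"
proof -
  interpret prob_space P by fact
  have M: "0 < M" using assms(1) by simp
  let ?g = "\<lambda>\<omega>. steinhaus_window M (\<lambda>m. y m \<omega>)"
  let ?T = "real (card \<Lambda>) * (1 - real (card \<Lambda>) / (real M)\<^sup>2)"
  let ?c = "real (card \<Lambda>) / real M + sqrt (real (card \<Lambda>) / \<epsilon> * (1 - real (card \<Lambda>) / (real M)\<^sup>2))"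
  let ?good = "{\<omega> \<in> space P. sigma_max_sq (analysis_mat M \<Lambda> (?g \<omega>)) \<le> ?c}"
  have y: "y m \<in> borel_measurable P" if "m < M" for m
    using assms(3) that by (auto simp: indep_vars_def)
  \<comment> \<open>The threshold \<open>?T / \<epsilon>\<close> is exactly the radicand in the
    claimed bound.\<close>
  have "1 - \<epsilon> \<le> prob {\<omega> \<in> space P. off_diag_energy M \<Lambda> (?g \<omega>) \<le> ?T / \<epsilon>}"
    by (rule prob_le_of_expectation_le)
      (use off_diag_energy_expectation[OF M assms(3-5)] \<open>0 < \<epsilon>\<close> in
        \<open>auto simp: off_diag_energy_def intro!: sum_nonneg\<close>)
  \<comment> \<open>Passing from the inclusion of events to their probabilities needs the larger
    event to be measurable.\<close>
  also have "\<dots> \<le> prob ?good"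
  proof (rule finite_measure_mono)
    show "{\<omega> \<in> space P. off_diag_energy M \<Lambda> (?g \<omega>) \<le> ?T / \<epsilon>} \<subseteq> ?good"
    proof clarify
      fix \<omega> assume "off_diag_energy M \<Lambda> (?g \<omega>) \<le> ?T / \<epsilon>"
      then have "sqrt (off_diag_energy M \<Lambda> (?g \<omega>)) \<le> sqrt (real (card \<Lambda>) / \<epsilon> * (1 - real (card \<Lambda>) / (real M)\<^sup>2))"
        by simp
      then show "sigma_max_sq (analysis_mat M \<Lambda> (?g \<omega>)) \<le> ?c"
        unfolding sigma_max_sq_analysis_le_iff[OF M assms(5)]
        by (intro ballI order_trans[OF analysis_energy_le[OF M]] add_left_mono) auto
    qed
    show "?good \<in> events" by (rule sets_sigma_max_sq_le[OF M assms(5) y])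
  qed
  finally show ?thesis .
qed

end
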